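(* Let $S=K[x_1,\dots,x_n]$ be a standard graded polynomial ring over a field $K$ and let $I\subset S$ be a nonzero proper polymatroidal ideal. Then $$\mathrm{v}(I^k)=\alpha(I)k-1\quad\text{for all } k\ge1.$$
   Context: For a monomial ideal $I$, $G(I)$ is its minimal monomial generating set; $\deg_{x_i}(u)$ is the exponent of $x_i$ in the monomial $u$. A monomial ideal $I\subset S$ generated in a single degree is called polymatroidal if for all $u,v\in G(I)$ and all $i$ with $\deg_{x_i}(u)>\deg_{x_i}(v)$ there exists $j$ with $\deg_{x_j}(u)<\deg_{x_j}(v)$ and $x_j(u/x_i)\in G(I)$. For a graded ideal $I\subset S=\bigoplus_d S_d$: $\alpha(I)=\min\{d: I_d\ne0\}$, $\mathrm{Ass}(I)$ is the set of associated primes of $S/I$, and $\mathrm{v}(I)=\min\{d: \exists f\in S_d\text{ with } (I:f)\in\mathrm{Ass}(I)\}$. *)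

theory Defs
  imports Complex_Main "HOL-Library.Poly_Mapping"
begin

text \<open>
  The standard graded polynomial ring \<open>K[x\<^sub>1, \<dots>, x\<^sub>n]\<close> is the monoid algebra of exponent
  vectors: a monomial is a finitely supported map \<open>'n \<Rightarrow>\<^sub>0 nat\<close> and a polynomial a finitely
  supported map from monomials to coefficients. For the finite type \<open>'n\<close> of variables,
  \<open>n = CARD('n)\<close>; multiplication of monomials is addition of exponent vectors.
\<close>

type_synonym 'n monomial = "'n \<Rightarrow>\<^sub>0 nat"
type_synonym ('n, 'k) mpoly = "'n monomial \<Rightarrow>\<^sub>0 'k"

section \<open>Ideals of a commutative ring\<close>

text \<open>
  A ring is a module over itself: \<open>ideal.subspace I\<close> says that \<open>I\<close> is an ideal, and
  \<open>ideal.span B\<close> is the ideal generated by \<open>B\<close>.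
\<close>

global_interpretation ideal: module "(*) :: 'a::comm_ring_1 \<Rightarrow> 'a \<Rightarrow> 'a"
  by standard (simp_all add: algebra_simps)

definition prime_ideal :: "'a::comm_ring_1 set \<Rightarrow> bool" where
  "prime_ideal P \<longleftrightarrow>
     ideal.subspace P \<and> P \<noteq> UNIV \<and> (\<forall>a b. a * b \<in> P \<longrightarrow> a \<in> P \<or> b \<in> P)"

primrec ideal_power :: "'a::comm_ring_1 set \<Rightarrow> nat \<Rightarrow> 'a set" where
  "ideal_power I 0 = UNIV"
| "ideal_power I (Suc k) = ideal.span {a * b | a b. a \<in> I \<and> b \<in> ideal_power I k}"

definition colon :: "'a::comm_ring_1 set \<Rightarrow> 'a \<Rightarrow> 'a set" where
  "colon I f = {g. g * f \<in> I}"

text \<open>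
  The associated primes of the module \<open>S/I\<close>: the prime ideals that are the annihilator of an
  element of \<open>S/I\<close>. The annihilator of the class of \<open>g\<close> is \<open>(I : g)\<close>.
\<close>

definition Ass :: "'a::comm_ring_1 set \<Rightarrow> 'a set set" where
  "Ass I = {P. prime_ideal P \<and> (\<exists>g. P = colon I g)}"

section \<open>The grading\<close>

definition mdeg :: "'n::finite monomial \<Rightarrow> nat" where
  "mdeg m = (\<Sum>i\<in>UNIV. Poly_Mapping.lookup m i)"

text \<open>The homogeneous component \<open>S\<^sub>d\<close>; it contains \<open>0\<close> for every \<open>d\<close>.\<close>

definition hcomp :: "nat \<Rightarrow> ('n::finite, 'k::comm_ring_1) mpoly set" where
  "hcomp d = {f. \<forall>m\<in>Poly_Mapping.keys f. mdeg m = d}"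

definition alpha :: "('n::finite, 'k::comm_ring_1) mpoly set \<Rightarrow> nat" where
  "alpha I = (LEAST d. I \<inter> hcomp d \<noteq> {0})"

definition v_number :: "('n::finite, 'k::comm_ring_1) mpoly set \<Rightarrow> nat" where
  "v_number I = (LEAST d. \<exists>f\<in>hcomp d. colon I f \<in> Ass I)"

section \<open>Monomial and polymatroidal ideals\<close>

text \<open>Sets of monomials are kept as sets of exponent vectors, also in \<open>min_gens\<close>.\<close>

definition monom_span :: "'n::finite monomial set \<Rightarrow> ('n, 'k::comm_ring_1) mpoly set" where
  "monom_span M = ideal.span ((\<lambda>m. Poly_Mapping.single m 1) ` M)"

definition monomial_ideal :: "('n::finite, 'k::comm_ring_1) mpoly set \<Rightarrow> bool" where
  "monomial_ideal I \<longleftrightarrow> (\<exists>M. I = monom_span M)"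

definition is_min_gens ::
    "('n::finite, 'k::comm_ring_1) mpoly set \<Rightarrow> 'n monomial set \<Rightarrow> bool" where
  "is_min_gens I M \<longleftrightarrow> monom_span M = I \<and> (\<forall>N. N \<subset> M \<longrightarrow> monom_span N \<noteq> I)"

text \<open>\<open>G(I)\<close>; lemma \<open>ex1_min_gens\<close> below shows that it exists uniquely for a monomial ideal.\<close>

definition min_gens :: "('n::finite, 'k::comm_ring_1) mpoly set \<Rightarrow> 'n monomial set" where
  "min_gens I = (THE M. is_min_gens I M)"

text \<open>
  \<open>u - single i 1 + single j 1\<close> is the exponent vector of \<open>x\<^sub>j (u / x\<^sub>i)\<close>; the truncated
  subtraction is harmless because \<open>Poly_Mapping.lookup u i > 0\<close> there.
\<close>

definition polymatroidal :: "('n::finite, 'k::comm_ring_1) mpoly set \<Rightarrow> bool" where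
  "polymatroidal I \<longleftrightarrow>
     monomial_ideal I \<and>
     (\<exists>d. \<forall>u\<in>min_gens I. mdeg u = d) \<and>
     (\<forall>u\<in>min_gens I. \<forall>v\<in>min_gens I. \<forall>i. Poly_Mapping.lookup u i > Poly_Mapping.lookup v i \<longrightarrow>
        (\<exists>j. Poly_Mapping.lookup u j < Poly_Mapping.lookup v j \<and>
             u - Poly_Mapping.single i 1 + Poly_Mapping.single j 1 \<in> min_gens I))"

section \<open>Well-definedness of the minimal monomial generating set\<close>

lemma mdeg_add: "mdeg (a + b) = mdeg a + mdeg b"
  by (simp add: mdeg_def lookup_add sum.distrib)

lemma mdeg_eq_0_iff: "mdeg a = 0 \<longleftrightarrow> a = 0"
  by (auto simp: mdeg_def intro!: poly_mapping_eqI)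

lemma keys_monom_span:
  assumes "f \<in> monom_span M" "m \<in> Poly_Mapping.keys f"
  shows "\<exists>u\<in>M. \<exists>w. m = u + w"
proof -
  let ?T = "{f. \<forall>m\<in>Poly_Mapping.keys f. \<exists>u\<in>M. \<exists>w. m = u + w}"
  have "ideal.subspace ?T"
  proof (rule ideal.subspaceI)
    show "0 \<in> ?T" by simp
    show "x + y \<in> ?T" if "x \<in> ?T" "y \<in> ?T" for x y
      using that keys_add[of x y] by blast
    show "c * x \<in> ?T" if x: "x \<in> ?T" for c x
    proof (clarify)
      fix m assume "m \<in> Poly_Mapping.keys (c * x)"
      then obtain a b where "m = a + b" "b \<in> Poly_Mapping.keys x" using keys_mult[of c x] by blast
      moreover then obtain u w where "u \<in> M" "b = u + w" using x by blast
      ultimately have "m = u + (a + w)" by (simp add: ac_simps)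
      then show "\<exists>u\<in>M. \<exists>w. m = u + w" using \<open>u \<in> M\<close> by blast
    qed
  qed
  moreover have "(\<lambda>m. Poly_Mapping.single m 1) ` M \<subseteq> ?T"
    by (force split: if_splits intro: exI[of _ 0])
  ultimately have "monom_span M \<subseteq> ?T"
    unfolding monom_span_def by (rule ideal.span_minimal[rotated])
  then show ?thesis using assms by blast
qed

lemma single_in_monom_span_iff:
  "(Poly_Mapping.single m 1 :: ('n::finite, 'k::comm_ring_1) mpoly) \<in> monom_span M
     \<longleftrightarrow> (\<exists>u\<in>M. \<exists>w. m = u + w)"
proof
  assume "(Poly_Mapping.single m 1 :: ('n, 'k) mpoly) \<in> monom_span M"
  then show "\<exists>u\<in>M. \<exists>w. m = u + w" by (rule keys_monom_span) simp
next
  assume "\<exists>u\<in>M. \<exists>w. m = u + w"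
  then obtain u w where "u \<in> M" and m: "m = u + w" by blast
  then have "(Poly_Mapping.single u 1 :: ('n, 'k) mpoly) \<in> monom_span M"
    unfolding monom_span_def by (intro ideal.span_base) simp
  then have "(Poly_Mapping.single w 1 * Poly_Mapping.single u 1 :: ('n, 'k) mpoly) \<in> monom_span M"
    unfolding monom_span_def by (rule ideal.span_scale)
  then show "(Poly_Mapping.single m 1 :: ('n, 'k) mpoly) \<in> monom_span M"
    by (simp add: mult_single m add.commute)
qed

lemma monom_span_subset_iff:
  "(monom_span N :: ('n::finite, 'k::comm_ring_1) mpoly set) \<subseteq> monom_span M
     \<longleftrightarrow> (\<forall>v\<in>N. \<exists>u\<in>M. \<exists>w. v = u + w)"
proof -
  have "(monom_span N :: ('n, 'k) mpoly set) \<subseteq> monom_span M \<longleftrightarrow>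
        (\<forall>v\<in>N. (Poly_Mapping.single v 1 :: ('n, 'k) mpoly) \<in> monom_span M)"
  proof
    assume "(monom_span N :: ('n, 'k) mpoly set) \<subseteq> monom_span M"
    then show "\<forall>v\<in>N. (Poly_Mapping.single v 1 :: ('n, 'k) mpoly) \<in> monom_span M"
      unfolding monom_span_def using ideal.span_superset by blast
  next
    assume "\<forall>v\<in>N. (Poly_Mapping.single v 1 :: ('n, 'k) mpoly) \<in> monom_span M"
    then show "(monom_span N :: ('n, 'k) mpoly set) \<subseteq> monom_span M"
      unfolding monom_span_def by (intro ideal.span_minimal ideal.subspace_span) blast
  qed
  then show ?thesis by (simp add: single_in_monom_span_iff)
qed

lemma is_min_gens_antichain:
  assumes M: "is_min_gens I M" and "u \<in> M" "u' \<in> M" "u = u' + w"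
  shows "w = 0"
proof (rule ccontr)
  assume "w \<noteq> 0"
  then have "u' \<noteq> u" using assms(4) by auto
  then have "\<exists>x\<in>M - {u}. \<exists>w. v = x + w" if "v \<in> M" for v
    using that assms(3,4) by (cases "v = u") (auto intro: exI[of _ 0] bexI[of _ v])
  then have "monom_span M \<subseteq> (monom_span (M - {u}) :: ('a, 'b) mpoly set)"
    by (simp add: monom_span_subset_iff)
  moreover have "(monom_span (M - {u}) :: ('a, 'b) mpoly set) \<subseteq> monom_span M"
    unfolding monom_span_def by (intro ideal.span_mono) auto
  ultimately have "monom_span (M - {u}) = I" using M by (auto simp: is_min_gens_def)
  moreover have "M - {u} \<subset> M" using \<open>u \<in> M\<close> by blast
  ultimately show False using M by (auto simp: is_min_gens_def)
qed

lemma is_min_gens_unique: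
  assumes "is_min_gens I M" "is_min_gens I N"
  shows "M = N"
proof -
  have *: "A \<subseteq> B" if A: "is_min_gens I A" and B: "is_min_gens I B" for A B
  proof
    fix u assume u: "u \<in> A"
    have "monom_span A = I" "monom_span B = I" using A B by (auto simp: is_min_gens_def)
    then have AB: "\<forall>v\<in>A. \<exists>u\<in>B. \<exists>w. v = u + w" and BA: "\<forall>v\<in>B. \<exists>u\<in>A. \<exists>w. v = u + w"
      by (simp_all flip: monom_span_subset_iff[where 'k='b])
    obtain x w where x: "x \<in> B" "u = x + w" using AB u by blast
    obtain y z where y: "y \<in> A" "x = y + z" using BA x(1) by blast
    have "z + w = 0" using is_min_gens_antichain[OF A u y(1)] x(2) y(2) by (simp add: add.assoc)
    then have "w = 0" by (metis add_is_0 mdeg_add mdeg_eq_0_iff)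
    then show "u \<in> B" using x by simp
  qed
  from *[OF assms] *[OF assms(2,1)] show ?thesis by blast
qed

lemma ex1_min_gens:
  assumes "monomial_ideal I"
  shows "\<exists>!M. is_min_gens I M"
proof -
  obtain M where I: "I = monom_span M" using assms by (auto simp: monomial_ideal_def)
  define N where "N = {u \<in> M. \<forall>x\<in>M. \<forall>w. u = x + w \<longrightarrow> w = 0}"
  have "\<exists>x\<in>N. \<exists>w. u = x + w" if "u \<in> M" for u
    using that
  proof (induction "mdeg u" arbitrary: u rule: less_induct)
    case less
    show ?case
    proof (cases "u \<in> N")
      case True
      then show ?thesis by (intro bexI[of _ u] exI[of _ 0]) simp_all
    next
      case False
      then obtain x w where xw: "x \<in> M" "u = x + w" "w \<noteq> 0" using less.prems by (auto simp: N_def)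
      then have "mdeg x < mdeg u" using mdeg_eq_0_iff[of w] by (simp add: mdeg_add)
      then obtain y z where "y \<in> N" "x = y + z" using less.hyps xw(1) by blast
      then show ?thesis using xw(2) by (metis add.assoc)
    qed
  qed
  then have "I \<subseteq> monom_span N" by (simp add: I monom_span_subset_iff)
  moreover have "monom_span N \<subseteq> I"
    unfolding I monom_span_def by (intro ideal.span_mono) (auto simp: N_def)
  moreover have "monom_span L \<noteq> I" if L: "L \<subset> N" for L
  proof
    assume "monom_span L = I"
    moreover obtain u where u: "u \<in> N" "u \<notin> L" using L by blast
    ultimately have "\<forall>v\<in>M. \<exists>x\<in>L. \<exists>w. v = x + w"
      using I by (simp flip: monom_span_subset_iff[where 'k='b])
    then obtain x w where "x \<in> L" "u = x + w" using u by (auto simp: N_def)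
    moreover then have "x \<in> M" using L by (auto simp: N_def)
    ultimately have "w = 0" using u by (auto simp: N_def)
    then show False using \<open>u = x + w\<close> \<open>x \<in> L\<close> u by simp
  qed
  ultimately have "is_min_gens I N" by (auto simp: is_min_gens_def)
  then show ?thesis using is_min_gens_unique by blast
qed

end

theory Submission
  imports Defs
begin

text \<open>
  Write \<open>M = G(I)\<close>, all of whose elements have degree \<open>d = \<alpha>(I)\<close>, so that \<open>I\<^sup>k\<close> is generated by
  the monomials with exponent vector in the \<open>k\<close>-fold sumset \<open>kM\<close>.

  Lower bound. If \<open>(I\<^sup>k : f)\<close> is prime, it contains the monomials of \<open>I\<^sup>k\<close>, hence some variable
  \<open>x\<^sub>i\<close>. Now \<open>x\<^sub>i f\<close> is a nonzero element of \<open>I\<^sup>k\<close>, so \<open>f\<close> has degree at least \<open>d k - 1\<close>.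

  Upper bound. Fix \<open>w \<in> M\<close> and a variable \<open>x\<^sub>i\<close> dividing \<open>x\<^sup>w\<close>, and take \<open>f = x\<^bsup>kw\<^esup> / x\<^sub>i\<close>. Let \<open>T\<close> be
  the set of all \<open>j\<close> with \<open>x\<^sub>j (x\<^sup>w / x\<^sub>i) \<in> G(I)\<close>; then \<open>i \<in> T\<close>, and \<open>x\<^sub>j f \<in> I\<^sup>k\<close> for \<open>j \<in> T\<close>.
  Conversely every monomial of \<open>(I\<^sup>k : f)\<close> is divisible by some \<open>x\<^sub>j\<close> with \<open>j \<in> T\<close>, so that
  \<open>(I\<^sup>k : f)\<close> is the prime ideal generated by the variables in \<open>T\<close>. The reason is that \<open>T\<close> is
  closed under further exchanges at \<open>w\<close> (lemma \<open>exchange_trans\<close>), which forces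
  \<open>\<Sum>\<^sub>T w \<le> \<Sum>\<^sub>T v\<close> for every \<open>v \<in> M\<close> (lemma \<open>exchange_set_sum_le\<close>). This linear inequality
  passes to sums: for \<open>v \<in> kM\<close> it gives \<open>\<Sum>\<^sub>T kw \<le> \<Sum>\<^sub>T v\<close>, so some coordinate of \<open>v\<close> in \<open>T\<close> exceeds
  that of \<open>kw\<close> diminished by one at \<open>i\<close>, the exponent vector of \<open>f\<close>. In particular it is not necessary to know that \<open>I\<^sup>k\<close> is
  itself polymatroidal.
\<close>

section \<open>Exchange sets\<close>

text \<open>
  The exponent vector of \<open>x\<^sub>j (x\<^sup>u / x\<^sub>i)\<close>. It is meaningful only if \<open>x\<^sub>i\<close> divides \<open>x\<^sup>u\<close>.
\<close>

definition exch :: "'n monomial \<Rightarrow> 'n \<Rightarrow> 'n \<Rightarrow> 'n monomial" where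
  "exch u i j = u - Poly_Mapping.single i 1 + Poly_Mapping.single j 1"

lemma lookup_exch:
  "Poly_Mapping.lookup (exch u i j) l =
     Poly_Mapping.lookup u l - (if l = i then 1 else 0) + (if l = j then 1 else 0)"
  by (simp add: exch_def lookup_add lookup_minus lookup_single when_def)

lemma exch_same: "Poly_Mapping.lookup u i > 0 \<Longrightarrow> exch u i i = u"
  by (rule poly_mapping_eqI) (simp add: lookup_exch)

text \<open>
  The exchange property of the generators of a polymatroidal ideal, without the assumption that
  they all have the same degree.
\<close>

definition exchange_closed :: "'n monomial set \<Rightarrow> bool" where
  "exchange_closed M \<longleftrightarrow>
     (\<forall>u\<in>M. \<forall>v\<in>M. \<forall>i. Poly_Mapping.lookup u i > Poly_Mapping.lookup v i \<longrightarrow>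
        (\<exists>j. Poly_Mapping.lookup u j < Poly_Mapping.lookup v j \<and> exch u i j \<in> M))"

lemma exchange_closedE:
  assumes "exchange_closed M" "u \<in> M" "v \<in> M"
    and "Poly_Mapping.lookup v i < Poly_Mapping.lookup u i"
  obtains j where "Poly_Mapping.lookup u j < Poly_Mapping.lookup v j" "exch u i j \<in> M"
  using assms unfolding exchange_closed_def by blast

text \<open>
  For distinct \<open>i\<close>, \<open>j\<close>, \<open>l\<close>, lower \<open>exch w j l\<close> at \<open>i\<close> by an exchange towards \<open>exch w i j\<close>: the
  only coordinate at which the latter is larger is \<open>j\<close>, and raising it gives \<open>exch w i l\<close>.
\<close>

lemma exchange_trans:
  assumes M: "exchange_closed M" and w: "w \<in> M"
    and i: "Poly_Mapping.lookup w i > 0" and j: "Poly_Mapping.lookup w j > 0"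
    and ij: "exch w i j \<in> M" and jl: "exch w j l \<in> M"
  shows "exch w i l \<in> M"
proof -
  consider "i = j" | "i = l" | "j = l" | "i \<noteq> j" "i \<noteq> l" "j \<noteq> l" by blast
  then show ?thesis
  proof cases
    case 2
    then show ?thesis using w i by (simp add: exch_same)
  next
    case 4
    have "Poly_Mapping.lookup (exch w i j) i < Poly_Mapping.lookup (exch w j l) i"
      using 4 i by (simp add: lookup_exch)
    then obtain m where
        m: "Poly_Mapping.lookup (exch w j l) m < Poly_Mapping.lookup (exch w i j) m"
      and mem: "exch (exch w j l) i m \<in> M"
      using exchange_closedE[OF M jl ij] by blast
    have "m = j" using m 4 by (auto simp: lookup_exch split: if_splits)
    moreover have "exch (exch w j l) i j = exch w i l"
      by (rule poly_mapping_eqI) (use 4 j in \<open>auto simp: lookup_exch\<close>)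
    ultimately show ?thesis using mem by simp
  qed (use ij jl in simp_all)
qed

text \<open>
  The descent in the proof moves \<open>v\<close> towards \<open>w\<close>: a violation of the inequality provides an
  exchange at \<open>v\<close> that lowers a coordinate in \<open>T\<close>, hence preserves the violation.
\<close>

lemma exchange_set_sum_le:
  fixes M :: "'n::finite monomial set"
  assumes M: "exchange_closed M" and w: "w \<in> M" and i: "Poly_Mapping.lookup w i > 0"
  defines "T \<equiv> {j. exch w i j \<in> M}"
  assumes "v \<in> M"
  shows "(\<Sum>t\<in>T. Poly_Mapping.lookup w t) \<le> (\<Sum>t\<in>T. Poly_Mapping.lookup v t)"
  using \<open>v \<in> M\<close>
proof (induction "\<Sum>t\<in>T. Poly_Mapping.lookup v t - Poly_Mapping.lookup w t"
    arbitrary: v rule: less_induct)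
  case less
  show ?case
  proof (rule ccontr)
    assume viol: "\<not> ?case"
    then obtain t where t: "t \<in> T" "Poly_Mapping.lookup v t < Poly_Mapping.lookup w t"
      by (meson not_le sum_mono)
    obtain j where j: "Poly_Mapping.lookup w j < Poly_Mapping.lookup v j" "exch w t j \<in> M"
      using exchange_closedE[OF M w less.prems t(2)] .
    have "exch w i j \<in> M"
      using exchange_trans[OF M w i _ _ j(2)] t by (simp add: T_def)
    then have jT: "j \<in> T" by (simp add: T_def)
    obtain s where s: "Poly_Mapping.lookup v s < Poly_Mapping.lookup w s" "exch v j s \<in> M"
      using exchange_closedE[OF M less.prems w j(1)] .
    have "s \<noteq> j" using s j by auto
    have "(\<Sum>t\<in>T. Poly_Mapping.lookup (exch v j s) t - Poly_Mapping.lookup w t)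
        < (\<Sum>t\<in>T. Poly_Mapping.lookup v t - Poly_Mapping.lookup w t)"
    proof (rule sum_strict_mono_ex1)
      show "\<forall>t\<in>T. Poly_Mapping.lookup (exch v j s) t - Poly_Mapping.lookup w t
          \<le> Poly_Mapping.lookup v t - Poly_Mapping.lookup w t"
        using s(1) by (auto simp: lookup_exch)
      show "\<exists>t\<in>T. Poly_Mapping.lookup (exch v j s) t - Poly_Mapping.lookup w t
          < Poly_Mapping.lookup v t - Poly_Mapping.lookup w t"
        using jT j(1) \<open>s \<noteq> j\<close> by (intro bexI[of _ j]) (auto simp: lookup_exch)
    qed simp
    then have "(\<Sum>t\<in>T. Poly_Mapping.lookup w t) \<le> (\<Sum>t\<in>T. Poly_Mapping.lookup (exch v j s) t)"
      using less.hyps s(2) by blast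
    also have "\<dots> \<le> (\<Sum>t\<in>T. Poly_Mapping.lookup v t)"
    proof -
      have "(\<Sum>t\<in>T. Poly_Mapping.lookup (exch v j s) t) + 1
          = (\<Sum>t\<in>T. Poly_Mapping.lookup (exch v j s) t + (if t = j then 1 else 0))"
        using jT by (simp add: sum.distrib)
      also have "\<dots> = (\<Sum>t\<in>T. Poly_Mapping.lookup v t + (if t = s then 1 else 0))"
        using j(1) \<open>s \<noteq> j\<close> by (intro sum.cong) (auto simp: lookup_exch)
      also have "\<dots> \<le> (\<Sum>t\<in>T. Poly_Mapping.lookup v t) + 1"
        by (simp add: sum.distrib)
      finally show ?thesis by simp
    qed
    finally show False using viol by simp
  qed
qed

section \<open>Sumsets and powers of monomial ideals\<close>

text \<open>The set of all sums of \<open>k\<close> elements of \<open>M\<close>, repetitions allowed.\<close>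

primrec sumset :: "'n monomial set \<Rightarrow> nat \<Rightarrow> 'n monomial set" where
  "sumset M 0 = {0}"
| "sumset M (Suc k) = {a + b | a b. a \<in> M \<and> b \<in> sumset M k}"

lemma mdeg_single: "mdeg (Poly_Mapping.single (i :: 'n::finite) c) = c"
  by (simp add: mdeg_def lookup_single when_def)

lemma mdeg_sumset:
  assumes "\<forall>u\<in>M. mdeg u = d" and "v \<in> sumset M k"
  shows "mdeg v = d * k"
  using assms(2) by (induction k arbitrary: v) (auto simp: mdeg_add assms(1) mdeg_eq_0_iff)

lemma sumset_sum_ge:
  assumes "\<And>v. v \<in> M \<Longrightarrow> c \<le> (\<Sum>t\<in>T. Poly_Mapping.lookup v t)" and "v \<in> sumset M k"
  shows "k * c \<le> (\<Sum>t\<in>T. Poly_Mapping.lookup v t)"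
  using assms(2)
proof (induction k arbitrary: v)
  case (Suc k)
  then obtain a b where ab: "v = a + b" "a \<in> M" "b \<in> sumset M k" by auto
  then show ?case
    using assms(1)[OF ab(2)] Suc.IH[OF ab(3)] by (simp add: lookup_add sum.distrib)
qed simp

text \<open>The multiple \<open>k w\<close>, the exponent vector of the \<open>k\<close>-th power of \<open>x\<^sup>w\<close>.\<close>

primrec nfold :: "nat \<Rightarrow> 'n monomial \<Rightarrow> 'n monomial" where
  "nfold 0 w = 0"
| "nfold (Suc k) w = w + nfold k w"

lemma lookup_nfold: "Poly_Mapping.lookup (nfold k w) t = k * Poly_Mapping.lookup w t"
  by (induction k) (simp_all add: lookup_add)

lemma nfold_mem_sumset: "w \<in> M \<Longrightarrow> nfold k w \<in> sumset M k"
  by (induction k) auto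

lemma in_monom_span_iff:
  fixes f :: "('n::finite, 'k::comm_ring_1) mpoly"
  shows "f \<in> monom_span M \<longleftrightarrow> (\<forall>m\<in>Poly_Mapping.keys f. \<exists>u\<in>M. \<exists>w. m = u + w)"
proof
  assume *: "\<forall>m\<in>Poly_Mapping.keys f. \<exists>u\<in>M. \<exists>w. m = u + w"
  have "f = (\<Sum>m\<in>Poly_Mapping.keys f.
      Poly_Mapping.single 0 (Poly_Mapping.lookup f m) * Poly_Mapping.single m 1)"
    by (rule poly_mapping_eqI)
      (auto simp: mult_single lookup_sum lookup_single when_def in_keys_iff)
  also have "\<dots> \<in> monom_span M"
    using * single_in_monom_span_iff[where 'k = 'k]
    unfolding monom_span_def by (intro ideal.span_sum ideal.span_scale) blast
  finally show "f \<in> monom_span M" .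
qed (blast dest: keys_monom_span)

lemma ideal_power_monom_span:
  "ideal_power (monom_span M :: ('n::finite, 'k::comm_ring_1) mpoly set) k
     = monom_span (sumset M k)"
proof (induction k)
  case 0
  show ?case by (auto simp: in_monom_span_iff)
next
  case (Suc k)
  let ?P = "{a * b | a b. a \<in> (monom_span M :: ('n, 'k) mpoly set)
                        \<and> b \<in> monom_span (sumset M k)}"
  have "ideal.span ?P \<subseteq> monom_span (sumset M (Suc k))"
  proof (rule ideal.span_minimal)
    show "?P \<subseteq> monom_span (sumset M (Suc k))"
    proof clarify
      fix a b :: "('n, 'k) mpoly"
      assume a: "a \<in> monom_span M" and b: "b \<in> monom_span (sumset M k)"
      show "a * b \<in> monom_span (sumset M (Suc k))"
        unfolding in_monom_span_iff
      proof
        fix m assume "m \<in> Poly_Mapping.keys (a * b)"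
        then obtain p q where "m = p + q" "p \<in> Poly_Mapping.keys a" "q \<in> Poly_Mapping.keys b"
          using keys_mult[of a b] by blast
        moreover then obtain u x v y where "u \<in> M" "p = u + x" "v \<in> sumset M k" "q = v + y"
          using a b by (meson in_monom_span_iff)
        ultimately have "u + v \<in> sumset M (Suc k)" "m = (u + v) + (x + y)"
          by (auto simp: ac_simps)
        then show "\<exists>u\<in>sumset M (Suc k). \<exists>w. m = u + w" by blast
      qed
    qed
  qed (simp add: monom_span_def)
  moreover have "monom_span (sumset M (Suc k)) \<subseteq> ideal.span ?P"
    unfolding monom_span_def[of "sumset M (Suc k)"]
  proof (rule ideal.span_minimal)
    show "(\<lambda>m. Poly_Mapping.single m 1) ` sumset M (Suc k) \<subseteq> ideal.span ?P"
    proof clarify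
      fix m assume "m \<in> sumset M (Suc k)"
      then obtain a b where ab: "m = a + b" "a \<in> M" "b \<in> sumset M k" by auto
      then have "(Poly_Mapping.single a 1 :: ('n, 'k) mpoly) \<in> monom_span M"
        "(Poly_Mapping.single b 1 :: ('n, 'k) mpoly) \<in> monom_span (sumset M k)"
        by (auto simp: monom_span_def intro: ideal.span_base)
      moreover have "(Poly_Mapping.single m 1 :: ('n, 'k) mpoly)
          = Poly_Mapping.single a 1 * Poly_Mapping.single b 1"
        by (simp add: mult_single ab)
      ultimately show "(Poly_Mapping.single m 1 :: ('n, 'k) mpoly) \<in> ideal.span ?P"
        by (intro ideal.span_base) blast
    qed
  qed simp
  ultimately show ?case using Suc.IH by auto
qed

lemma alpha_monom_span:
  assumes "\<forall>u\<in>M. mdeg u = d" and "M \<noteq> {}"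
  shows "alpha (monom_span M :: ('n::finite, 'k::comm_ring_1) mpoly set) = d"
  unfolding alpha_def
proof (rule Least_equality)
  obtain u where u: "u \<in> M" using assms by blast
  let ?g = "Poly_Mapping.single u 1 :: ('n, 'k) mpoly"
  have "?g \<in> monom_span M \<inter> hcomp d"
    using u assms(1) by (force simp: in_monom_span_iff hcomp_def split: if_splits)
  moreover have "?g \<noteq> 0" by (metis keys_single keys_zero insert_not_empty zero_neq_one)
  ultimately show "(monom_span M :: ('n, 'k) mpoly set) \<inter> hcomp d \<noteq> {0}" by blast
next
  fix e
  assume "(monom_span M :: ('n, 'k) mpoly set) \<inter> hcomp e \<noteq> {0}"
  moreover have "(0 :: ('n, 'k) mpoly) \<in> monom_span M \<inter> hcomp e"
    by (simp add: in_monom_span_iff hcomp_def)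
  ultimately obtain f :: "('n, 'k) mpoly" where f: "f \<in> monom_span M" "f \<in> hcomp e" "f \<noteq> 0"
    by blast
  then obtain m where m: "m \<in> Poly_Mapping.keys f" by (metis keys_eq_empty equals0I)
  then obtain x w where "x \<in> M" "m = x + w" using f(1) by (auto simp: in_monom_span_iff)
  moreover have "mdeg m = e" using m f(2) by (simp add: hcomp_def)
  ultimately show "d \<le> e" using assms(1) by (auto simp: mdeg_add)
qed

section \<open>Ideals generated by variables\<close>

text \<open>
  If \<open>p + q\<close> arises in no other way as a sum of monomials of \<open>a\<close> and \<open>b\<close>, no cancellation can
  occur at \<open>p + q\<close> in the product.
\<close>

lemma lookup_mult_unique:
  fixes a b :: "('n, 'k::comm_ring_1) mpoly"
  assumes uniq: "\<And>l r. l \<in> Poly_Mapping.keys a \<Longrightarrow> r \<in> Poly_Mapping.keys b \<Longrightarrow>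
      l + r = p + q \<Longrightarrow> l = p \<and> r = q"
  shows "Poly_Mapping.lookup (a * b) (p + q) = Poly_Mapping.lookup a p * Poly_Mapping.lookup b q"
proof -
  have "Poly_Mapping.lookup a l * (\<Sum>r. Poly_Mapping.lookup b r when p + q = l + r)
      = (Poly_Mapping.lookup a p * Poly_Mapping.lookup b q when l = p)" for l
  proof (cases "l \<in> Poly_Mapping.keys a")
    case True
    have "(\<Sum>r. Poly_Mapping.lookup b r when p + q = l + r)
        = (\<Sum>r. (Poly_Mapping.lookup b q when l = p) when r = q)"
    proof (rule Sum_any.cong)
      fix r
      show "(Poly_Mapping.lookup b r when p + q = l + r)
          = ((Poly_Mapping.lookup b q when l = p) when r = q)"
        using uniq[OF True, of r] by (cases "r \<in> Poly_Mapping.keys b")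
          (auto simp: when_def in_keys_iff)
    qed
    then show ?thesis by (simp add: when_def)
  next
    case False
    then show ?thesis by (auto simp: when_def in_keys_iff)
  qed
  then show ?thesis by (simp add: lookup_mult)
qed

lemma keys_mult_single_one:
  "Poly_Mapping.keys ((g :: ('n, 'k::comm_ring_1) mpoly) * Poly_Mapping.single q 1)
     = (\<lambda>m. m + q) ` Poly_Mapping.keys g"
proof
  show "Poly_Mapping.keys (g * Poly_Mapping.single q 1) \<subseteq> (\<lambda>m. m + q) ` Poly_Mapping.keys g"
    using keys_mult[of g "Poly_Mapping.single q 1"] by auto
  show "(\<lambda>m. m + q) ` Poly_Mapping.keys g \<subseteq> Poly_Mapping.keys (g * Poly_Mapping.single q 1)"
  proof clarify
    fix m assume m: "m \<in> Poly_Mapping.keys g"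
    have "Poly_Mapping.lookup (g * Poly_Mapping.single q 1) (m + q)
        = Poly_Mapping.lookup g m * Poly_Mapping.lookup (Poly_Mapping.single q 1) q"
      by (rule lookup_mult_unique) auto
    then show "m + q \<in> Poly_Mapping.keys (g * Poly_Mapping.single q 1)"
      using m by (simp add: in_keys_iff)
  qed
qed

text \<open>
  An additive injection into a linearly ordered monoid of exponent vectors, i.e. a monomial
  order; the type of variables itself carries no order.
\<close>

lemma ex_monomial_order:
  "\<exists>\<phi> :: 'n::finite monomial \<Rightarrow> nat monomial. inj \<phi> \<and> (\<forall>a b. \<phi> (a + b) = \<phi> a + \<phi> b)"
proof -
  obtain h :: "'n \<Rightarrow> nat" where h: "inj h"
    using finite_imp_inj_to_nat_seg[of "UNIV :: 'n set"] by auto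
  define \<phi> where "\<phi> m = (\<Sum>j\<in>UNIV. Poly_Mapping.single (h j) (Poly_Mapping.lookup m j))"
    for m :: "'n monomial"
  have "Poly_Mapping.lookup (\<phi> m) (h j) = Poly_Mapping.lookup m j" for m j
    using h by (simp add: \<phi>_def lookup_sum lookup_single when_def inj_eq)
  then have "inj \<phi>" by (metis injI poly_mapping_eqI)
  moreover have "\<phi> (a + b) = \<phi> a + \<phi> b" for a b
    by (simp add: \<phi>_def lookup_add single_add sum.distrib)
  ultimately show ?thesis by blast
qed

text \<open>
  The ideal of all polynomials each of whose monomials is divisible by a variable in \<open>T\<close>, that
  is, the ideal generated by these variables.
\<close>

definition var_ideal :: "'n set \<Rightarrow> ('n, 'k::comm_ring_1) mpoly set" where
  "var_ideal T = {g. \<forall>m\<in>Poly_Mapping.keys g. \<exists>j\<in>T. Poly_Mapping.lookup m j > 0}"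

text \<open>
  Primality: for \<open>a\<close> and \<open>b\<close> outside the ideal, consider in each of them the largest monomial, in
  some monomial order, that avoids the variables in \<open>T\<close>. Their product survives in \<open>a b\<close>. Monomials in the ideal cannot interfere, because a
  product of monomials avoids the variables in \<open>T\<close> only if both factors do.
\<close>

lemma prime_ideal_var_ideal:
  "prime_ideal (var_ideal T :: ('n::finite, 'k::idom) mpoly set)"
  unfolding prime_ideal_def
proof (intro conjI allI impI)
  let ?P = "var_ideal T :: ('n, 'k) mpoly set"
  show "ideal.subspace ?P"
  proof (rule ideal.subspaceI)
    show "0 \<in> ?P" by (simp add: var_ideal_def)
    show "x + y \<in> ?P" if "x \<in> ?P" "y \<in> ?P" for x y
      using that keys_add[of x y] unfolding var_ideal_def by blast
    show "c * x \<in> ?P" if x: "x \<in> ?P" for c x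
      unfolding var_ideal_def
    proof clarify
      fix m assume "m \<in> Poly_Mapping.keys (c * x)"
      then obtain a b where m: "m = a + b" "b \<in> Poly_Mapping.keys x"
        using keys_mult[of c x] by blast
      then obtain j where "j \<in> T" "Poly_Mapping.lookup b j > 0"
        using x by (auto simp: var_ideal_def)
      then show "\<exists>j\<in>T. Poly_Mapping.lookup m j > 0"
        by (intro bexI[of _ j]) (simp_all add: m lookup_add)
    qed
  qed
  have "1 \<notin> ?P" by (simp add: var_ideal_def)
  then show "?P \<noteq> UNIV" by blast
  fix a b :: "('n, 'k) mpoly"
  assume ab: "a * b \<in> ?P"
  show "a \<in> ?P \<or> b \<in> ?P"
  proof (rule ccontr)
    assume *: "\<not> ?thesis"
    obtain \<phi> :: "'n monomial \<Rightarrow> nat monomial"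
      where inj: "inj \<phi>" and add: "\<And>x y. \<phi> (x + y) = \<phi> x + \<phi> y"
      using ex_monomial_order by blast
    define off where "off m \<longleftrightarrow> (\<forall>j\<in>T. Poly_Mapping.lookup m j = 0)" for m :: "'n monomial"
    have max: "\<exists>p\<in>Poly_Mapping.keys c. off p \<and> (\<forall>l\<in>Poly_Mapping.keys c. off l \<longrightarrow> \<phi> l \<le> \<phi> p)"
      if "c \<notin> ?P" for c :: "('n, 'k) mpoly"
    proof -
      let ?A = "{p \<in> Poly_Mapping.keys c. off p}"
      have "finite ?A" by simp
      moreover have "?A \<noteq> {}" using that by (auto simp: var_ideal_def off_def)
      ultimately obtain p where "p \<in> ?A" "\<phi> p = Max (\<phi> ` ?A)"
        by (metis (no_types, lifting) Max_in finite_imageI image_iff image_is_empty)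
      then show ?thesis using \<open>finite ?A\<close> by auto
    qed
    obtain p where p: "p \<in> Poly_Mapping.keys a" "off p"
      "\<And>l. l \<in> Poly_Mapping.keys a \<Longrightarrow> off l \<Longrightarrow> \<phi> l \<le> \<phi> p" using max * by blast
    obtain q where q: "q \<in> Poly_Mapping.keys b" "off q"
      "\<And>l. l \<in> Poly_Mapping.keys b \<Longrightarrow> off l \<Longrightarrow> \<phi> l \<le> \<phi> q" using max * by blast
    have off_add: "off (x + y) \<longleftrightarrow> off x \<and> off y" for x y
      by (auto simp: off_def lookup_add)
    have "Poly_Mapping.lookup (a * b) (p + q) = Poly_Mapping.lookup a p * Poly_Mapping.lookup b q"
    proof (rule lookup_mult_unique)
      fix l r
      assume lr: "l \<in> Poly_Mapping.keys a" "r \<in> Poly_Mapping.keys b" "l + r = p + q"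
      then have "off l" "off r" using off_add p(2) q(2) by metis+
      then have "\<phi> l \<le> \<phi> p" "\<phi> r \<le> \<phi> q" using lr p q by auto
      moreover have "\<phi> l + \<phi> r = \<phi> p + \<phi> q" using lr(3) by (metis add)
      ultimately have "\<phi> l = \<phi> p"
        by (metis add_less_le_mono less_irrefl order_le_less)
      then have "l = p" using inj by (simp add: inj_eq)
      then show "l = p \<and> r = q" using lr(3) by simp
    qed
    also have "\<dots> \<noteq> 0" using p(1) q(1) by (simp add: in_keys_iff)
    finally have "p + q \<in> Poly_Mapping.keys (a * b)" by (simp add: in_keys_iff)
    moreover have "off (p + q)" using off_add p(2) q(2) by blast
    ultimately show False using ab by (auto simp: var_ideal_def off_def)
  qed
qed

lemma prime_ideal_monomial_imp_variable:
  fixes P :: "('n::finite, 'k::comm_ring_1) mpoly set"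
  assumes P: "prime_ideal P" and "Poly_Mapping.single m 1 \<in> P"
  shows "\<exists>i. Poly_Mapping.single (Poly_Mapping.single i 1) 1 \<in> P"
  using assms(2)
proof (induction "mdeg m" arbitrary: m rule: less_induct)
  case less
  show ?case
  proof (cases "m = 0")
    case True
    then have "1 \<in> P" using less.prems by simp
    then have "c \<in> P" for c
      using P ideal.subspace_scale[of P 1 c] by (simp add: prime_ideal_def)
    then show ?thesis by blast
  next
    case False
    then obtain i where i: "Poly_Mapping.lookup m i > 0"
      by (metis gr0I poly_mapping_eqI lookup_zero)
    define m' where "m' = m - Poly_Mapping.single i 1"
    have m: "m = Poly_Mapping.single i 1 + m'"
      by (rule poly_mapping_eqI)
        (use i in \<open>auto simp: m'_def lookup_add lookup_minus lookup_single when_def\<close>)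
    have "(Poly_Mapping.single m 1 :: ('n, 'k) mpoly)
        = Poly_Mapping.single (Poly_Mapping.single i 1) 1 * Poly_Mapping.single m' 1"
      by (simp add: mult_single m)
    then have "Poly_Mapping.single (Poly_Mapping.single i 1) 1 \<in> P \<or> Poly_Mapping.single m' 1 \<in> P"
      using P less.prems by (simp add: prime_ideal_def)
    moreover have "mdeg m' < mdeg m" by (simp add: m mdeg_add mdeg_single)
    ultimately show ?thesis using less.hyps by blast
  qed
qed

section \<open>The v-number of a power\<close>

lemma prime_colon_degree_ge:
  fixes f :: "('n::finite, 'k::comm_ring_1) mpoly"
  assumes N: "\<forall>u\<in>N. mdeg u = D" "N \<noteq> {}"
    and P: "prime_ideal (colon (monom_span N) f)" and f: "f \<in> hcomp e"
  shows "D \<le> e + 1"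
proof -
  obtain u where "u \<in> N" using N by blast
  then have "f * Poly_Mapping.single u 1 \<in> monom_span N"
    unfolding monom_span_def by (intro ideal.span_scale ideal.span_base) simp
  then have "Poly_Mapping.single u 1 \<in> colon (monom_span N) f"
    by (simp add: colon_def mult.commute)
  then obtain i where
    "Poly_Mapping.single (Poly_Mapping.single i 1) 1 \<in> colon (monom_span N) f"
    using prime_ideal_monomial_imp_variable[OF P] by blast
  then have xf: "f * Poly_Mapping.single (Poly_Mapping.single i 1) 1 \<in> monom_span N"
    by (simp add: colon_def mult.commute)
  have "f \<noteq> 0"
  proof
    assume "f = 0"
    then have "colon (monom_span N) f = UNIV" by (simp add: colon_def in_monom_span_iff)
    then show False using P by (simp add: prime_ideal_def)
  qed
  then obtain m where m: "m \<in> Poly_Mapping.keys f" by (metis keys_eq_empty equals0I)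
  then have "m + Poly_Mapping.single i 1
      \<in> Poly_Mapping.keys (f * Poly_Mapping.single (Poly_Mapping.single i 1) 1)"
    unfolding keys_mult_single_one by blast
  then obtain v w where "v \<in> N" "m + Poly_Mapping.single i 1 = v + w"
    using xf unfolding in_monom_span_iff by blast
  moreover then have "mdeg m + 1 = mdeg v + mdeg w" by (metis mdeg_add mdeg_single)
  moreover have "mdeg m = e" using m f by (simp add: hcomp_def)
  ultimately show ?thesis using N(1) by simp
qed

text \<open>
  The colon ideal of \<open>x\<^bsup>(k+1)w\<^esup> / x\<^sub>i\<close>, written as \<open>x\<^bsup>kw\<^esup> (x\<^sup>w / x\<^sub>i)\<close>.
\<close>

lemma colon_power_eq_var_ideal:
  fixes M :: "'n::finite monomial set" and k :: nat
  assumes M: "exchange_closed M" and w: "w \<in> M" and i: "Poly_Mapping.lookup w i > 0"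
  defines "q \<equiv> (w - Poly_Mapping.single i 1) + nfold k w"
  shows "colon (monom_span (sumset M (Suc k)))
      (Poly_Mapping.single q 1 :: ('n, 'k::comm_ring_1) mpoly) = var_ideal {j. exch w i j \<in> M}"
proof -
  let ?T = "{j. exch w i j \<in> M}"
  have iT: "i \<in> ?T" using w i by (simp add: exch_same)
  have q: "Poly_Mapping.lookup q t + (if t = i then 1 else 0) = Suc k * Poly_Mapping.lookup w t"
    for t
    using i by (simp add: q_def lookup_add lookup_minus lookup_single lookup_nfold when_def)
  have key: "(\<exists>u\<in>sumset M (Suc k). \<exists>x. m + q = u + x)
      \<longleftrightarrow> (\<exists>j\<in>?T. Poly_Mapping.lookup m j > 0)" for m
  proof
    assume "\<exists>u\<in>sumset M (Suc k). \<exists>x. m + q = u + x"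
    then obtain u x where u: "u \<in> sumset M (Suc k)" and mq: "m + q = u + x" by blast
    have "Suc k * (\<Sum>t\<in>?T. Poly_Mapping.lookup w t) \<le> (\<Sum>t\<in>?T. Poly_Mapping.lookup u t)"
      using sumset_sum_ge[OF exchange_set_sum_le[OF M w i] u] .
    moreover have "(\<Sum>t\<in>?T. Poly_Mapping.lookup q t) + 1
        = Suc k * (\<Sum>t\<in>?T. Poly_Mapping.lookup w t)"
    proof -
      have "(\<Sum>t\<in>?T. Poly_Mapping.lookup q t) + 1
          = (\<Sum>t\<in>?T. Poly_Mapping.lookup q t + (if t = i then 1 else 0))"
        using iT by (simp add: sum.distrib)
      then show ?thesis unfolding q by (simp only: sum_distrib_left)
    qed
    ultimately have "(\<Sum>t\<in>?T. Poly_Mapping.lookup q t) < (\<Sum>t\<in>?T. Poly_Mapping.lookup u t)"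
      by simp
    then obtain j where j: "j \<in> ?T" "Poly_Mapping.lookup q j < Poly_Mapping.lookup u j"
      by (meson not_le sum_mono)
    have "Poly_Mapping.lookup m j + Poly_Mapping.lookup q j
        = Poly_Mapping.lookup u j + Poly_Mapping.lookup x j"
      using mq by (metis lookup_add)
    then show "\<exists>j\<in>?T. Poly_Mapping.lookup m j > 0" using j by (intro bexI[of _ j]) auto
  next
    assume "\<exists>j\<in>?T. Poly_Mapping.lookup m j > 0"
    then obtain j where j: "exch w i j \<in> M" "Poly_Mapping.lookup m j > 0" by blast
    have "exch w i j + nfold k w \<in> sumset M (Suc k)" using j(1) nfold_mem_sumset[OF w] by auto
    moreover have "m + q = (exch w i j + nfold k w) + (m - Poly_Mapping.single j 1)"
      by (rule poly_mapping_eqI)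
        (use j(2) in \<open>auto simp: q_def exch_def lookup_add lookup_minus lookup_single when_def\<close>)
    ultimately show "\<exists>u\<in>sumset M (Suc k). \<exists>x. m + q = u + x" by blast
  qed
  have "g \<in> colon (monom_span (sumset M (Suc k))) (Poly_Mapping.single q 1) \<longleftrightarrow> g \<in> var_ideal ?T"
    for g :: "('n, 'k) mpoly"
    by (simp only: colon_def var_ideal_def mem_Collect_eq in_monom_span_iff keys_mult_single_one
        ball_simps key)
  then show ?thesis by blast
qed

theorem theorem5p5:
  fixes I :: "('n::finite, 'k::field) mpoly set"
    and k :: nat
  assumes "polymatroidal I"
    and "I \<noteq> {0}"
    and "I \<noteq> UNIV"
    and "k \<ge> 1"
  shows "int (v_number (ideal_power I k)) = int (alpha I) * int k - 1"
proof -
  define M where "M = min_gens I"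
  have "is_min_gens I M"
    using assms(1) theI'[OF ex1_min_gens[of I]] by (simp add: M_def min_gens_def polymatroidal_def)
  then have I: "I = monom_span M" by (simp add: is_min_gens_def)
  obtain d where d: "\<forall>u\<in>M. mdeg u = d"
    using assms(1) by (auto simp: polymatroidal_def M_def)
  have ex: "exchange_closed M"
    using assms(1) unfolding polymatroidal_def exchange_closed_def exch_def M_def by blast
  have "M \<noteq> {}" using assms(2) by (auto simp: I monom_span_def)
  then obtain w where w: "w \<in> M" by blast
  have "w \<noteq> 0"
  proof
    assume "w = 0"
    then have "f \<in> I" for f
      using w unfolding I in_monom_span_iff by (metis add_0)
    then have "I = UNIV" by blast
    then show False using assms(3) by blast
  qed
  then obtain i where i: "Poly_Mapping.lookup w i > 0"
    by (metis gr0I poly_mapping_eqI lookup_zero)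
  obtain k' where k: "k = Suc k'" using assms(4) by (cases k) auto
  define q where "q = (w - Poly_Mapping.single i 1) + nfold k' w"
  let ?f = "Poly_Mapping.single q 1 :: ('n, 'k) mpoly"
  have pow: "ideal_power I k = monom_span (sumset M k)"
    by (simp add: I ideal_power_monom_span)
  have wk: "nfold k w \<in> sumset M k" using w by (rule nfold_mem_sumset)
  have "q + Poly_Mapping.single i 1 = nfold k w"
    by (rule poly_mapping_eqI)
      (use i in \<open>auto simp: q_def k lookup_add lookup_minus lookup_single when_def\<close>)
  then have "mdeg q + 1 = d * k"
    using mdeg_sumset[OF d wk] by (metis mdeg_add mdeg_single)
  then have deg: "?f \<in> hcomp (d * k - 1)" "d * k \<ge> 1" by (simp add: hcomp_def, linarith)
  have "v_number (ideal_power I k) = d * k - 1"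
    unfolding v_number_def
  proof (rule Least_equality)
    have "colon (ideal_power I k) ?f = var_ideal {j. exch w i j \<in> M}"
      unfolding pow q_def unfolding k by (rule colon_power_eq_var_ideal[OF ex w i])
    then have "prime_ideal (colon (ideal_power I k) ?f)"
      by (simp add: prime_ideal_var_ideal)
    then have "colon (ideal_power I k) ?f \<in> Ass (ideal_power I k)"
      unfolding Ass_def by blast
    then show "\<exists>f\<in>hcomp (d * k - 1). colon (ideal_power I k) f \<in> Ass (ideal_power I k)"
      using deg(1) by blast
  next
    fix e
    assume "\<exists>f\<in>hcomp e. colon (ideal_power I k) f \<in> Ass (ideal_power I k)"
    then obtain f :: "('n, 'k) mpoly"
      where "f \<in> hcomp e" "prime_ideal (colon (monom_span (sumset M k)) f)"
      unfolding pow Ass_def by blast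
    then have "d * k \<le> e + 1"
      using prime_colon_degree_ge[of "sumset M k" "d * k" f e] mdeg_sumset[OF d] wk by blast
    then show "d * k - 1 \<le> e" by simp
  qed
  then show ?thesis
    using deg(2) alpha_monom_span[OF d \<open>M \<noteq> {}\<close>, where 'k = 'k]
    by (simp add: I of_nat_diff del: of_nat_mult flip: of_nat_mult)
qed

end
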